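(* Let 3 players divide 2 cakes, each cut into 2 pieces, and let each player $j$ have preferences $\mathrm{Pref}_j$ satisfying the assumptions described in the context. Then there exist a division $x$, two distinct players $j\ne j'$, and disjoint piece selections $s_j\in\mathrm{Pref}_j(x)$, $s_{j'}\in\mathrm{Pref}_{j'}(x)$.
   Context: Model of multi-cake division. There are $m$ cakes, each of length $1$, and cake $i$ is cut into $k$ pieces (here $m=k=2$). A division is an $m\times k$ matrix $x=(x_{ij})$ with $x_{ij}\ge 0$ and $\sum_{j} x_{ij}=1$ for every $i$; $x_{ij}$ is the length of the $j$-th piece of cake $i$. A piece selection is a map $s:\{1,\dots,m\}\to\{1,\dots,k\}$ choosing one piece from each cake. Two piece selections $s,s'$ are disjoint if $s(i)\ne s'(i)$ for every cake $i$. Each player has preferences given by assigning to every division $x$ a nonempty set $\mathrm{Pref}(x)$ of preferred piece selections (those not worse than any other at $x$ for that player); each player's preferences depend only on that player. Assumptions: (hungry) no $s\in\mathrm{Pref}(x)$ contains an empty piece, i.e. $x_{i,s(i)}>0$ for all $i$ (a player prefers a nonempty piece in a cake to an empty piece in that cake, other cakes fixed); (closed) for each piece selection $s$ the set of divisions $x$ with $s\in\mathrm{Pref}(x)$ is closed. *)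

theory Defs
  imports "HOL-Analysis.Analysis"
begin

text \<open>
  The finite index types \<open>'m\<close> and \<open>'k\<close> enumerate the cakes and the pieces of each cake;
  \<open>x $ i $ j\<close> is the length of piece \<open>j\<close> of cake \<open>i\<close>.
\<close>

definition divisions :: "(real ^ 'k ^ 'm) set" where
  "divisions = {x. (\<forall>i j. 0 \<le> x $ i $ j) \<and> (\<forall>i. (\<Sum>j\<in>UNIV. x $ i $ j) = 1)}"

type_synonym ('m, 'k) selection = "'m \<Rightarrow> 'k"

definition disjoint_selections :: "('m, 'k) selection \<Rightarrow> ('m, 'k) selection \<Rightarrow> bool" where
  "disjoint_selections s s' \<longleftrightarrow> (\<forall>i. s i \<noteq> s' i)"

text \<open>
  A player's preferences are a map sending each division to the set of its preferred piece
  selections. Values of this map outside \<open>divisions\<close> are irrelevant and left unconstrained.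
\<close>

type_synonym ('m, 'k) preference = "real ^ 'k ^ 'm \<Rightarrow> ('m, 'k) selection set"

definition always_prefers :: "('m::finite, 'k::finite) preference \<Rightarrow> bool" where
  "always_prefers Pref \<longleftrightarrow> (\<forall>x\<in>divisions. Pref x \<noteq> {})"

definition hungry :: "('m::finite, 'k::finite) preference \<Rightarrow> bool" where
  "hungry Pref \<longleftrightarrow> (\<forall>x\<in>divisions. \<forall>s\<in>Pref x. \<forall>i. 0 < x $ i $ s i)"

text \<open>
  The set \<open>divisions\<close> is itself closed, so closedness in the ambient space is the same as
  closedness relative to \<open>divisions\<close>.
\<close>

definition closed_preferences :: "('m::finite, 'k::finite) preference \<Rightarrow> bool" where
  "closed_preferences Pref \<longleftrightarrow> (\<forall>s. closed {x \<in> divisions. s \<in> Pref x})"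

end

theory Submission
  imports Defs
begin

text \<open>
  Suppose that at no division two distinct players prefer disjoint selections. Urysohn-type weights
  turn the preferences of each player into a continuous probability distribution on the selections,
  in such a way that distinct players never put positive weight on disjoint selections and no weight
  ever falls on an empty piece. Averaging over the players and taking marginals gives a continuous
  self-map of the space of divisions that preserves faces, so by Brouwer some division is sent to
  the uniform division. There each selection carries the same total weight as its complement, which
  forces this weight to come from a single player, hence to be at most \<open>1/2\<close>. So the four selections
  carry total weight at most \<open>2\<close>, although the three players distribute total weight \<open>3\<close>.
\<close>

lemma compact_divisions: "compact (divisions :: (real ^ 'k::finite ^ 'm::finite) set)"
proof -
  have eq: "(divisions :: (real ^ 'k ^ 'm) set) = {x. \<forall>i j. 0 \<le> x $ i $ j} \<inter>
      {x. \<forall>i. (\<Sum>j\<in>UNIV. x $ i $ j) = 1}"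
    by (auto simp: divisions_def)
  have "closed (divisions :: (real ^ 'k ^ 'm) set)"
    unfolding eq
    by (intro closed_Int closed_Collect_all closed_Collect_le closed_Collect_eq continuous_intros)
  moreover have "norm x \<le> (\<Sum>i\<in>(UNIV::'m set). \<Sum>j\<in>(UNIV::'k set). 1)"
    if x: "x \<in> divisions" for x :: "real ^ 'k ^ 'm"
  proof -
    have "x $ i $ j \<le> 1" for i j
      using x member_le_sum[of j UNIV "\<lambda>j. x $ i $ j"] by (auto simp: divisions_def)
    then have "norm (x $ i $ j) \<le> 1" for i j
      using x by (auto simp: divisions_def)
    then have "norm (x $ i) \<le> (\<Sum>j\<in>(UNIV::'k set). 1)" for i
      by (intro order_trans[OF norm_le_l1_cart] sum_mono) auto
    then show ?thesis
      unfolding norm_vec_def[of x]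
      by (intro order_trans[OF L2_set_le_sum] sum_mono) auto
  qed
  then have "bounded (divisions :: (real ^ 'k ^ 'm) set)"
    unfolding bounded_iff by blast
  ultimately show ?thesis
    by (simp add: compact_eq_bounded_closed)
qed

lemma convex_divisions: "convex (divisions :: (real ^ 'k::finite ^ 'm::finite) set)"
  by (auto simp: convex_def divisions_def sum.distrib sum_distrib_left[symmetric])

text \<open>Brouwer is applied to \<open>x + y - f x\<close>, truncated at 0 and rescaled so that
  each row sums to 1. Truncation only raises the row sums, which were 1, so the rescaling is
  defined. A zero entry of a fixed point would be zero in \<open>f x\<close> too, and the map would
  turn it into a positive one. So nothing was truncated, the factors are 1, and
  \<open>f x = y\<close>.\<close>

lemma face_preserving_surjective:
  fixes f :: "real ^ 'k::finite ^ 'm::finite \<Rightarrow> real ^ 'k ^ 'm"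
  assumes cont: "continuous_on divisions f"
    and self: "\<And>x. x \<in> divisions \<Longrightarrow> f x \<in> divisions"
    and face: "\<And>x i j. x \<in> divisions \<Longrightarrow> x $ i $ j = 0 \<Longrightarrow> f x $ i $ j = 0"
    and y: "y \<in> divisions" and pos: "\<And>i j. 0 < y $ i $ j"
  shows "\<exists>x\<in>divisions. f x = y"
proof -
  define r where "r x i j = max 0 (x $ i $ j + y $ i $ j - f x $ i $ j)" for x i j
  define R where "R x i = (\<Sum>j\<in>UNIV. r x i j)" for x i
  define g :: "real ^ 'k ^ 'm \<Rightarrow> real ^ 'k ^ 'm" where "g x = (\<chi> i j. r x i j / R x i)" for x
  have R1: "1 \<le> R x i" if "x \<in> divisions" for x i
  proof -
    have "1 = (\<Sum>j\<in>UNIV. x $ i $ j + y $ i $ j - f x $ i $ j)"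
      using that self[OF that] y by (simp add: divisions_def sum.distrib sum_subtractf)
    also have "\<dots> \<le> R x i"
      unfolding R_def r_def by (intro sum_mono) auto
    finally show ?thesis .
  qed
  have "g x \<in> divisions" if "x \<in> divisions" for x
  proof -
    have "0 < R x i" for i
      using R1[OF that, of i] by linarith
    moreover have "0 \<le> r x i j" for i j
      by (simp add: r_def)
    moreover have "(\<Sum>j\<in>UNIV. r x i j / R x i) = R x i / R x i" for i
      by (simp only: R_def sum_divide_distrib)
    ultimately show ?thesis
      by (simp add: g_def divisions_def less_imp_le less_imp_neq[symmetric])
  qed
  moreover have "continuous_on divisions g"
  proof -
    have r: "continuous_on divisions (\<lambda>x. r x i j)" for i j
      unfolding r_def by (intro continuous_intros cont)
    moreover have "R x i \<noteq> 0" if "x \<in> divisions" for x i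
      using R1[OF that, of i] by linarith
    ultimately show ?thesis
      unfolding g_def R_def by (intro continuous_on_vec_lambda continuous_on_divide continuous_on_sum) auto
  qed
  ultimately obtain x where x: "x \<in> divisions" "g x = x"
    using brouwer[OF compact_divisions convex_divisions, of g] y by auto
  have xr: "x $ i $ j = r x i j / R x i" for i j
    using x(2) by (metis (no_types, lifting) g_def vec_lambda_beta)
  have "x $ i $ j \<noteq> 0" for i j
  proof
    assume 0: "x $ i $ j = 0"
    then have "r x i j = y $ i $ j"
      using face[OF x(1) 0] pos[of i j] by (simp add: r_def)
    then show False
      using 0 xr[of i j] pos[of i j] R1[OF x(1), of i] by simp
  qed
  then have "r x i j \<noteq> 0" for i j
    using xr by (metis div_0)
  then have r: "r x i j = x $ i $ j + y $ i $ j - f x $ i $ j" for i j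
    unfolding r_def by (metis max_def)
  have "R x i = 1" for i
    unfolding R_def r using x(1) self[OF x(1)] y
    by (simp add: divisions_def sum.distrib sum_subtractf)
  then have "f x $ i $ j = y $ i $ j" for i j
    using xr[of i j] r[of i j] by simp
  then show ?thesis
    using x(1) by (auto simp: vec_eq_iff)
qed

text \<open>When each cake \<open>i\<close> lies entirely in piece \<open>s i\<close>, hunger rules
  out every selection but \<open>s\<close>. This keeps the sets \<open>A j s\<close> below nonempty,
  as comparing distances to them requires.\<close>

lemma selection_preferred_somewhere:
  fixes s :: "('m::finite, 'k::finite) selection"
  assumes "always_prefers Pref" "hungry Pref"
  shows "\<exists>x\<in>divisions. s \<in> Pref x"
proof
  let ?x = "(\<chi> i j. if j = s i then 1 else 0) :: real ^ 'k ^ 'm"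
  show x: "?x \<in> divisions"
    by (simp add: divisions_def)
  obtain t where t: "t \<in> Pref ?x"
    using assms(1) x by (auto simp: always_prefers_def)
  then have pos: "0 < ?x $ i $ t i" for i
    using assms(2) x unfolding hungry_def by blast
  have "t i = s i" for i
    using pos[of i] by (simp split: if_splits)
  then have "t = s" ..
  then show "s \<in> Pref ?x"
    using t by simp
qed

text \<open>A selection may get positive weight where it is not preferred; the main argument needs
  only that conflicts and empty pieces are respected.\<close>

lemma preference_weights:
  fixes Pref :: "'p::finite \<Rightarrow> ('m::finite, 'k::finite) preference"
  assumes prefers: "\<And>j. always_prefers (Pref j)"
    and hungry: "\<And>j. hungry (Pref j)"
    and closed: "\<And>j. closed_preferences (Pref j)"
    and conflict: "\<And>x j j' s s'. x \<in> divisions \<Longrightarrow> j \<noteq> j' \<Longrightarrow> s \<in> Pref j x \<Longrightarrow> s' \<in> Pref j' x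
      \<Longrightarrow> \<not> disjoint_selections s s'"
  obtains p :: "'p \<Rightarrow> ('m, 'k) selection \<Rightarrow> real ^ 'k ^ 'm \<Rightarrow> real"
  where "\<And>j s. continuous_on divisions (p j s)"
    and "\<And>j s x. x \<in> divisions \<Longrightarrow> 0 \<le> p j s x"
    and "\<And>j x. x \<in> divisions \<Longrightarrow> (\<Sum>s\<in>UNIV. p j s x) = 1"
    and "\<And>j s x i. x \<in> divisions \<Longrightarrow> x $ i $ s i = 0 \<Longrightarrow> p j s x = 0"
    and "\<And>j j' s s' x. x \<in> divisions \<Longrightarrow> j \<noteq> j' \<Longrightarrow> disjoint_selections s s'
      \<Longrightarrow> p j s x = 0 \<or> p j' s' x = 0"
proof -
  define A where "A j s = {x \<in> divisions. s \<in> Pref j x}" for j s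
  define E :: "('m, 'k) selection \<Rightarrow> (real ^ 'k ^ 'm) set" where "E s = (\<Union>i. {x. x $ i $ s i = 0})" for s
  define B where "B j s = E s \<union> (\<Union>j'\<in>-{j}. \<Union>s'\<in>Collect (disjoint_selections s). A j' s')" for j s
  \<comment> \<open>If \<open>w j s\<close> and \<open>w j' s'\<close> were both positive at \<open>x\<close> for a conflicting pair, then \<open>x\<close> would be
    strictly closer to each of \<open>A j s\<close> and \<open>A j' s'\<close> than to the other. Including \<open>E s\<close> in \<open>B j s\<close>
    makes the weight vanish on empty pieces and avoids the junk value \<open>infdist x {} = 0\<close>.\<close>
  define w where "w j s x = max 0 (infdist x (B j s) - infdist x (A j s))" for j s x
  define W where "W j x = (\<Sum>s\<in>UNIV. w j s x)" for j x
  have A_ne: "A j s \<noteq> {}" for j s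
    using selection_preferred_somewhere[OF prefers hungry] by (auto simp: A_def)
  have "closed (A j s)" for j s
    using closed by (auto simp: A_def closed_preferences_def)
  moreover have "closed (E s)" for s
    unfolding E_def by (intro closed_UN ballI closed_Collect_eq continuous_intros) auto
  ultimately have B_closed: "closed (B j s)" for j s
    unfolding B_def by (intro closed_Un closed_UN ballI) auto
  \<comment> \<open>The zero matrix is not a division, but \<open>E s\<close> is not restricted to
    divisions.\<close>
  have "0 \<in> B j s" for j s
    by (simp add: B_def E_def)
  then have B_ne: "B j s \<noteq> {}" for j s
    by blast
  have sym: "disjoint_selections s' s" if "disjoint_selections s s'" for s s' :: "('m, 'k) selection"
    using that unfolding disjoint_selections_def by metis
  \<comment> \<open>Hunger keeps \<open>A j s\<close> away from \<open>E s\<close>, and the absence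
    of disjoint preferred selections keeps it away from the rest. As \<open>B j s\<close> is closed,
    the weight is then positive wherever \<open>s\<close> is preferred.\<close>
  have AB: "x \<notin> B j s" if "x \<in> A j s" for x j s
  proof
    assume "x \<in> B j s"
    moreover have "x \<notin> E s"
      using that hungry[of j] by (auto simp: E_def A_def hungry_def) (metis less_irrefl)
    ultimately obtain j' s' where "j' \<noteq> j" "disjoint_selections s s'" "x \<in> A j' s'"
      by (auto simp: B_def)
    then show False
      using that conflict[of x j j' s s'] by (simp add: A_def)
  qed
  have w_nonneg: "0 \<le> w j s x" for j s x
    by (simp add: w_def)
  have w_pos: "0 < w j s x" if "x \<in> A j s" for j s x
    using AB[OF that] that infdist_pos_not_in_closed[OF B_closed B_ne] by (simp add: w_def)
  have W_pos: "0 < W j x" if x: "x \<in> divisions" for j x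
  proof -
    obtain s where "s \<in> Pref j x"
      using prefers[of j] x by (auto simp: always_prefers_def)
    then have "0 < w j s x"
      using x by (intro w_pos) (simp add: A_def)
    then show ?thesis
      unfolding W_def by (intro sum_pos2[of UNIV s]) (auto simp: w_nonneg)
  qed
  have cont: "continuous_on divisions (w j s)" for j s
    unfolding w_def by (intro continuous_intros)
  show ?thesis
  proof
    let ?p = "\<lambda>j s x. w j s x / W j x"
    show "continuous_on divisions (?p j s)" for j s
      using W_pos unfolding W_def
      by (intro continuous_on_divide continuous_on_sum cont) (auto simp: less_le)
    show "0 \<le> ?p j s x" if "x \<in> divisions" for j s x
      using W_pos[OF that, of j] w_nonneg[of j s x] by simp
    show "(\<Sum>s\<in>UNIV. ?p j s x) = 1" if "x \<in> divisions" for j x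
      using W_pos[OF that, of j] by (simp add: W_def sum_divide_distrib[symmetric])
    show "?p j s x = 0" if "x \<in> divisions" "x $ i $ s i = 0" for j s x i
    proof -
      have "x \<in> B j s"
        using that by (auto simp: B_def E_def)
      then have "w j s x = 0"
        using infdist_nonneg[of x "A j s"] by (simp add: w_def)
      then show ?thesis by simp
    qed
    show "?p j s x = 0 \<or> ?p j' s' x = 0"
      if "x \<in> divisions" "j \<noteq> j'" "disjoint_selections s s'" for j j' s s' x
    proof -
      have "A j' s' \<subseteq> B j s" "A j s \<subseteq> B j' s'"
        using that sym unfolding B_def by blast+
      then have "infdist x (B j s) \<le> infdist x (A j' s')" "infdist x (B j' s') \<le> infdist x (A j s)"
        using A_ne by (auto intro!: infdist_mono)
      then have "w j s x = 0 \<or> w j' s' x = 0"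
        unfolding w_def by linarith
      then show ?thesis by auto
    qed
  qed
qed

text \<open>If \<open>a j\<close> is nonzero, the conflict condition confines \<open>b\<close> to
  \<open>j\<close>; by balance \<open>b j\<close> is nonzero, which confines \<open>a\<close> to
  \<open>j\<close> in turn. Then \<open>a j = b j\<close>, and their sum is at most 1.\<close>

lemma balanced_weight_le_half:
  fixes a b :: "'p::finite \<Rightarrow> real"
  assumes "\<And>j. 0 \<le> a j" "\<And>j. 0 \<le> b j" "\<And>j. a j + b j \<le> 1"
    and conflict: "\<And>j j'. j \<noteq> j' \<Longrightarrow> a j = 0 \<or> b j' = 0"
    and balanced: "sum a UNIV = sum b UNIV"
  shows "sum a UNIV \<le> 1 / 2"
proof (cases "\<exists>j. a j \<noteq> 0")
  case True
  then obtain j where j: "a j \<noteq> 0" by blast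
  have single: "sum f UNIV = f j" if "\<And>j'. j' \<noteq> j \<Longrightarrow> f j' = 0" for f :: "'p \<Rightarrow> real"
    using that sum.mono_neutral_right[of UNIV "{j}" f] by auto
  have b: "sum b UNIV = b j"
    using conflict j by (intro single) metis
  have "0 < sum a UNIV"
    using assms(1) j by (intro sum_pos2[of UNIV j]) (auto simp: less_le)
  then have "b j \<noteq> 0"
    using b balanced by simp
  then have "sum a UNIV = a j"
    using conflict by (intro single) metis
  then show ?thesis
    using b balanced assms(3)[of j] by simp
qed simp

lemma sum_selections_2:
  fixes f :: "(2, 2) selection \<Rightarrow> real"
  defines "sel \<equiv> \<lambda>a b i. if i = (1::2) then a else (b::2)"
  shows "sum f {s. s 1 = c} = f (sel c 1) + f (sel c 2)"
    and "sum f {s. s 2 = c} = f (sel 1 c) + f (sel 2 c)"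
proof -
  have eq: "s = sel a b \<longleftrightarrow> s 1 = a \<and> s 2 = b" for s a b
    by (auto simp: sel_def fun_eq_iff forall_2)
  have "{s. s 1 = c} = {sel c 1, sel c 2}" "{s. s 2 = c} = {sel 1 c, sel 2 c}"
    unfolding set_eq_iff insert_iff eq using exhaust_2 by auto
  moreover have "sel c 1 \<noteq> sel c 2" "sel 1 c \<noteq> sel 2 c"
    by (auto simp: sel_def fun_eq_iff forall_2)
  ultimately show "sum f {s. s 1 = c} = f (sel c 1) + f (sel c 2)"
      "sum f {s. s 2 = c} = f (sel 1 c) + f (sel 2 c)"
    by simp_all
qed

theorem theorem4:
  fixes Pref :: "3 \<Rightarrow> (2, 2) preference"
  assumes "\<And>j. always_prefers (Pref j)"
    and "\<And>j. hungry (Pref j)"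
    and "\<And>j. closed_preferences (Pref j)"
  shows "\<exists>x\<in>divisions. \<exists>j j'. j \<noteq> j' \<and>
           (\<exists>s\<in>Pref j x. \<exists>s'\<in>Pref j' x. disjoint_selections s s')"
proof (rule ccontr)
  assume "\<not> ?thesis"
  then have no_disjoint: "\<And>x j j' s s'. x \<in> divisions \<Longrightarrow> j \<noteq> j' \<Longrightarrow> s \<in> Pref j x \<Longrightarrow> s' \<in> Pref j' x
      \<Longrightarrow> \<not> disjoint_selections s s'"
    by blast
  obtain p :: "3 \<Rightarrow> (2, 2) selection \<Rightarrow> real ^ 2 ^ 2 \<Rightarrow> real"
    where cont: "\<And>j s. continuous_on divisions (p j s)"
      and nonneg: "\<And>j s x. x \<in> divisions \<Longrightarrow> 0 \<le> p j s x"
      and sum1: "\<And>j x. x \<in> divisions \<Longrightarrow> (\<Sum>s\<in>UNIV. p j s x) = 1"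
      and empty: "\<And>j s x i. x \<in> divisions \<Longrightarrow> x $ i $ s i = 0 \<Longrightarrow> p j s x = 0"
      and conflict: "\<And>j j' s s' x. x \<in> divisions \<Longrightarrow> j \<noteq> j' \<Longrightarrow> disjoint_selections s s'
        \<Longrightarrow> p j s x = 0 \<or> p j' s' x = 0"
    by (rule preference_weights[of Pref, OF assms no_disjoint]) (assumption+, rule that)
  define P where "P s x = (\<Sum>j\<in>UNIV. p j s x)" for s x
  define q :: "real ^ 2 ^ 2 \<Rightarrow> real ^ 2 ^ 2"
    where "q x = (\<chi> i c. (\<Sum>s | s i = c. P s x) / 3)" for x
  have "\<exists>x\<in>divisions. q x = (\<chi> i c. 1 / 2)"
  proof (rule face_preserving_surjective)
    show "continuous_on divisions q"
      unfolding q_def P_def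
      by (intro continuous_on_vec_lambda continuous_on_divide continuous_on_sum cont continuous_on_const) auto
    show "q x \<in> divisions" if x: "x \<in> divisions" for x
    proof -
      have "(\<Sum>c\<in>UNIV. \<Sum>s | s i = c. P s x) = 3" for i
      proof -
        have "(\<Sum>c\<in>UNIV. \<Sum>s | s i = c. P s x) = (\<Sum>s\<in>UNIV. P s x)"
          using sum.group[of UNIV UNIV "\<lambda>s. s i" "\<lambda>s. P s x"] by simp
        also have "\<dots> = (\<Sum>j\<in>UNIV. \<Sum>s\<in>UNIV. p j s x)"
          unfolding P_def by (rule sum.swap)
        finally show ?thesis
          using sum1[OF x] by simp
      qed
      then show ?thesis
        using nonneg[OF x]
        by (auto simp: q_def divisions_def P_def sum_divide_distrib[symmetric] intro!: sum_nonneg)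
    qed
    show "q x $ i $ c = 0" if "x \<in> divisions" "x $ i $ c = 0" for x i c
      using that empty by (auto simp: q_def P_def intro!: sum.neutral)
  qed (auto simp: divisions_def)
  then obtain x where x: "x \<in> divisions" and "q x = (\<chi> i c. 1 / 2)"
    by blast
  \<comment> \<open>Three players distribute total weight 3, shared equally by the two pieces of
    each cake.\<close>
  then have marginal: "(\<Sum>s | s i = c. P s x) = 3 / 2" for i c
    by (auto simp: q_def vec_eq_iff dest!: spec[of _ i] spec[of _ c])
  define sel :: "2 \<Rightarrow> 2 \<Rightarrow> (2, 2) selection" where "sel = (\<lambda>a b i. if i = 1 then a else b)"
  have half: "P s x \<le> 1 / 2" if "disjoint_selections s t" "P s x = P t x" for s t
    unfolding P_def
  proof (rule balanced_weight_le_half[where b = "\<lambda>j. p j t x"])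
    have "s \<noteq> t"
      using that(1) by (auto simp: disjoint_selections_def)
    then have "p j s x + p j t x = (\<Sum>u\<in>{s, t}. p j u x)" for j
      by simp
    then show "p j s x + p j t x \<le> 1" for j
      using sum_mono2[of UNIV "{s, t}" "\<lambda>u. p j u x"] nonneg[OF x] sum1[OF x, of j] by simp
  qed (use that x nonneg conflict in \<open>auto simp: P_def\<close>)
  note m = marginal[of 1, unfolded sum_selections_2]
    marginal[of 2, unfolded sum_selections_2]
  \<comment> \<open>Two marginals that share one selection leave equal weights for the other two,
    which are complementary.\<close>
  have "P (sel 1 1) x \<le> 1 / 2"
    using m[of 1] m[of 2] by (intro half[of _ "sel 2 2"]) (auto simp: disjoint_selections_def sel_def)
  moreover have "P (sel 1 2) x \<le> 1 / 2"
    using m[of 1] m[of 2] by (intro half[of _ "sel 2 1"]) (auto simp: disjoint_selections_def sel_def)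
  \<comment> \<open>These two selections make up the marginal of piece 1 of cake 1, so at most 1
    would equal 3/2.\<close>
  ultimately show False
    using m(1)[of 1] by (simp add: sel_def)
qed

end
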